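(* Let $k$ be a field of characteristic zero, let $R$ be a UFD which is a finitely generated $k$-algebra, and let $B=R[X_1,X_2]$ be the polynomial ring in two variables over $R$. Let $D$ be an irreducible locally nilpotent $R$-derivation on $B$ such that $D^2X_1=D^2X_2=0$. Let $A=\mathrm{Ker}(D)$ and let $I_j=A\cap D^jB$ be the $j$-th image ideal of $D$. Then, for each $j\in\mathbb{N}$, $I_j=(DX_1,DX_2)^jA$.
   Context: All rings are commutative with unity; $\mathbb{N}$ is the set of non-negative integers. A locally nilpotent $R$-derivation on an $R$-algebra $B$ is an $R$-linear map $D:B\to B$ satisfying $D(ab)=aDb+bDa$ for all $a,b\in B$ such that for each $b\in B$ there is $n\in\mathbb{N}$ with $D^n b=0$. Its kernel is $\mathrm{Ker}(D)=\{b\in B: Db=0\}$. For $j\in\mathbb{N}$, the $j$-th image ideal of $D$ is the ideal $I_j=\mathrm{Ker}(D)\cap D^jB$ of $\mathrm{Ker}(D)$ (with $D^0=\mathrm{id}$). $D$ is irreducible if there is no non-unit $b\in B$ with $DB\subseteq bB$. The notation $(DX_1,DX_2)^jA$ means the $j$-th power of the ideal of $A$ generated by $DX_1$ and $DX_2$ (which lie in $A$). *)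

theory Defs
  imports "Berlekamp_Zassenhaus.Unique_Factorization_Poly"
begin

text \<open>
  An algebra over \<open>R\<close> is given by its structure map \<open>\<iota>\<close>, a ring homomorphism defined on \<open>R\<close>;
  the scalar multiple of \<open>b\<close> by \<open>r\<close> is \<open>\<iota> r * b\<close>.
\<close>

definition subalgebra :: "('k \<Rightarrow> 'r::comm_ring_1) \<Rightarrow> 'r set \<Rightarrow> bool" where
  "subalgebra \<iota> T \<longleftrightarrow> range \<iota> \<subseteq> T \<and>
     (\<forall>a\<in>T. \<forall>b\<in>T. a + b \<in> T) \<and> (\<forall>a\<in>T. - a \<in> T) \<and> (\<forall>a\<in>T. \<forall>b\<in>T. a * b \<in> T)"

definition finitely_generated_algebra :: "('k::comm_ring_1 \<Rightarrow> 'r::comm_ring_1) \<Rightarrow> bool" where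
  "finitely_generated_algebra \<iota> \<longleftrightarrow>
     comm_ring_hom \<iota> \<and> (\<exists>S. finite S \<and> subalgebra \<iota> hull S = UNIV)"

definition derivation :: "('r::comm_ring_1 \<Rightarrow> 'b::comm_ring_1) \<Rightarrow> ('b \<Rightarrow> 'b) \<Rightarrow> bool" where
  "derivation \<iota> D \<longleftrightarrow>
     (\<forall>a b. D (a + b) = D a + D b) \<and>
     (\<forall>r b. D (\<iota> r * b) = \<iota> r * D b) \<and>
     (\<forall>a b. D (a * b) = a * D b + b * D a)"

definition locally_nilpotent_derivation ::
    "('r::comm_ring_1 \<Rightarrow> 'b::comm_ring_1) \<Rightarrow> ('b \<Rightarrow> 'b) \<Rightarrow> bool" where
  "locally_nilpotent_derivation \<iota> D \<longleftrightarrow> derivation \<iota> D \<and> (\<forall>b. \<exists>n. (D ^^ n) b = 0)"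

definition irreducible_derivation :: "('b::comm_ring_1 \<Rightarrow> 'b) \<Rightarrow> bool" where
  "irreducible_derivation D \<longleftrightarrow> \<not> (\<exists>b. \<not> b dvd 1 \<and> range D \<subseteq> range ((*) b))"

definition Ker :: "('b::comm_ring_1 \<Rightarrow> 'b) \<Rightarrow> 'b set" where
  "Ker D = {b. D b = 0}"

definition image_ideal :: "('b::comm_ring_1 \<Rightarrow> 'b) \<Rightarrow> nat \<Rightarrow> 'b set" where
  "image_ideal D j = Ker D \<inter> range (D ^^ j)"

text \<open>
  Ideals of a subring \<open>A\<close>, given as a subset of the ambient ring. Closure under negation
  follows from \<open>- 1 \<in> A\<close>.
\<close>

definition ideal_of :: "'b::comm_ring_1 set \<Rightarrow> 'b set \<Rightarrow> bool" where
  "ideal_of A I \<longleftrightarrow> I \<subseteq> A \<and> 0 \<in> I \<and>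
     (\<forall>x\<in>I. \<forall>y\<in>I. x + y \<in> I) \<and> (\<forall>a\<in>A. \<forall>x\<in>I. a * x \<in> I)"

text \<open>
  \<open>ideal_of A hull S\<close> is the ideal of \<open>A\<close> generated by \<open>S\<close>; this is meaningful for
  \<open>S \<subseteq> A\<close> only (otherwise the hull is an empty intersection, that is, \<open>UNIV\<close>).
\<close>

definition ideal_product :: "'b::comm_ring_1 set \<Rightarrow> 'b set \<Rightarrow> 'b set \<Rightarrow> 'b set" where
  "ideal_product A I J = ideal_of A hull {x * y | x y. x \<in> I \<and> y \<in> J}"

primrec ideal_power :: "'b::comm_ring_1 set \<Rightarrow> 'b set \<Rightarrow> nat \<Rightarrow> 'b set" where
  "ideal_power A I 0 = A"
| "ideal_power A I (Suc n) = ideal_product A I (ideal_power A I n)"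

text \<open>
  \<open>R[X\<^sub>1, X\<^sub>2]\<close> is represented as \<open>R[X\<^sub>1][X\<^sub>2]\<close>, with structure map \<open>const2\<close>.
\<close>

definition const2 :: "'r::comm_ring_1 \<Rightarrow> 'r poly poly" where
  "const2 r = [:[:r:]:]"

definition X1 :: "'r::comm_ring_1 poly poly" where
  "X1 = [:[:0, 1:]:]"

definition X2 :: "'r::comm_ring_1 poly poly" where
  "X2 = [:0, 1:]"

end

theory Submission
  imports Defs
begin

text \<open>
  The hypotheses leave far fewer derivations than they seem to. Write \<open>f\<^sub>1 = D X\<^sub>1\<close> and
  \<open>f\<^sub>2 = D X\<^sub>2\<close>, so that \<open>D = f\<^sub>1 \<partial>\<^sub>1 + f\<^sub>2 \<partial>\<^sub>2\<close>. Irreducibility makes \<open>f\<^sub>1\<close> and \<open>f\<^sub>2\<close>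
  coprime. The equation \<open>D f\<^sub>1 = f\<^sub>1 \<partial>\<^sub>1 f\<^sub>1 + f\<^sub>2 \<partial>\<^sub>2 f\<^sub>1 = 0\<close> therefore makes \<open>f\<^sub>1\<close> a divisor of
  \<open>\<partial>\<^sub>2 f\<^sub>1\<close>; by degree \<open>\<partial>\<^sub>2 f\<^sub>1\<close> vanishes, and then so does \<open>\<partial>\<^sub>1 f\<^sub>1\<close>. The same holds for \<open>f\<^sub>2\<close> with the
  variables exchanged. Hence \<open>D = a \<partial>\<^sub>1 + b \<partial>\<^sub>2\<close> with coprime constants \<open>a, b \<in> R\<close>
  (\<open>slopes_constant\<close>).

  The inclusion of \<open>(a, b)\<^sup>jA\<close> in \<open>I\<^sub>j\<close> follows by induction from
  \<open>D\<^sup>n\<^sup>+\<^sup>1 (X\<^sub>i g) = (n + 1) f\<^sub>i D\<^sup>n g\<close> for \<open>D\<^sup>n g \<in> A\<close>, since \<open>n + 1\<close> is invertible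
  (\<open>ideal_power_subset_image_ideal\<close>).

  For the other inclusion, restrict polynomials to the line \<open>t \<mapsto> (a t, b t)\<close>. This is a ring
  homomorphism \<open>\<phi>\<close> from \<open>B\<close> to \<open>R[t]\<close> that turns \<open>D\<close> into \<open>d/dt\<close>, and its kernel is generated by the
  linear form \<open>F = b X\<^sub>1 - a X\<^sub>2\<close>, which lies in \<open>A\<close>. If \<open>D\<^sup>j g \<in> A\<close>, then \<open>\<phi> g\<close> has degree at most \<open>j\<close>. Split
  \<open>g = p + h\<close>, where \<open>p\<close> has total degree at most \<open>j\<close> and \<open>h\<close> consists of terms of higher degree.
  Then \<open>\<phi> h\<close> is divisible by \<open>t\<^sup>j\<^sup>+\<^sup>1\<close> and has degree at most \<open>j\<close>, so it vanishes and \<open>h = F h'\<close>.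
  Consequently \<open>D\<^sup>j g = D\<^sup>j p + F D\<^sup>j h'\<close>. Here \<open>D\<^sup>j p\<close> is a constant in \<open>(a, b)\<^sup>jA\<close>, and
  \<open>D\<^sup>j h'\<close> is an element of \<open>I\<^sub>j\<close> that is zero or of smaller degree than \<open>D\<^sup>j g\<close>, so induction on the degree of the
  element of \<open>I\<^sub>j\<close> finishes the proof (\<open>image_ideal_subset\<close>).
\<close>

\<comment> \<open>From here on, \<open>coprime\<close> is the notion for integral domains that asks each common divisor to be a unit.\<close>
hide_const (open) Rings.coprime

section \<open>Polynomials in two variables\<close>

lemma X1_mult_eq: "X1 * g = smult [:0, 1:] g"
  by (simp add: X1_def)

lemma X2_mult_eq: "X2 * g = pCons 0 g"
  by (simp add: X2_def)

lemma const2_add: "const2 (r + s) = const2 r + const2 s"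
  and const2_mult: "const2 (r * s) = const2 r * const2 s"
  and const2_0: "const2 0 = 0"
  and const2_1: "const2 1 = 1"
  by (simp_all add: const2_def)

lemma const2_of_nat: "const2 (of_nat n) = of_nat n"
  by (induction n) (simp_all add: const2_0 const2_1 const2_add)

lemma const2_eq_0_iff: "const2 r = 0 \<longleftrightarrow> r = 0"
  by (simp add: const2_def)

lemma const2_dvd_const2_iff:
  fixes r s :: "'r::idom"
  shows "const2 r dvd const2 s \<longleftrightarrow> r dvd s"
  by (simp add: const2_def)

lemma const2_dvd_1_iff:
  fixes r :: "'r::idom"
  shows "const2 r dvd 1 \<longleftrightarrow> r dvd 1"
  by (metis const2_1 const2_dvd_const2_iff)

lemma poly2_induct [case_names const X1 X2 add]:
  fixes P :: "'r::comm_ring_1 poly poly \<Rightarrow> bool"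
  assumes const: "\<And>r. P (const2 r)"
    and X1: "\<And>g. P g \<Longrightarrow> P (X1 * g)"
    and X2: "\<And>g. P g \<Longrightarrow> P (X2 * g)"
    and add: "\<And>g h. P g \<Longrightarrow> P h \<Longrightarrow> P (g + h)"
  shows "P g"
proof -
  have zero: "P 0" using const[of 0] by (simp add: const2_0)
  have single: "P [:q:]" for q
  proof (induction q)
    case 0
    then show ?case using zero by simp
  next
    case (pCons r q)
    have "[:pCons r q:] = const2 r + X1 * [:q:]"
      by (simp add: const2_def X1_def)
    then show ?case using const X1 add pCons by metis
  qed
  show ?thesis
  proof (induction g)
    case 0
    then show ?case using zero by simp
  next
    case (pCons q g)
    have "pCons q g = [:q:] + X2 * g" by (simp add: X2_def)
    then show ?case using single X2 add pCons by metis
  qed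
qed

definition partial1 :: "'r::idom poly poly \<Rightarrow> 'r poly poly" where
  "partial1 g = map_poly pderiv g"

lemma coeff_partial1: "coeff (partial1 g) n = pderiv (coeff g n)"
  by (simp add: partial1_def coeff_map_poly)

lemma partial1_add: "partial1 (g + h) = partial1 g + partial1 h"
  by (rule poly_eqI) (simp add: coeff_partial1 pderiv_add)

lemma partial1_const2: "partial1 (const2 r) = 0"
  by (rule poly_eqI) (simp add: coeff_partial1 const2_def coeff_pCons split: nat.split)

lemma partial1_X1_mult: "partial1 (X1 * g) = g + X1 * partial1 g"
  by (rule poly_eqI) (simp add: coeff_partial1 X1_mult_eq pderiv_pCons pderiv_mult)

lemma partial1_X2_mult: "partial1 (X2 * g) = X2 * partial1 g"
  by (rule poly_eqI) (simp add: coeff_partial1 X2_mult_eq coeff_pCons split: nat.split)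

lemma degree_eq_0_if_pderiv_eq_0:
  fixes p :: "'a::idom poly"
  assumes nat: "\<And>n. (of_nat (Suc n) :: 'a) \<noteq> 0" and "pderiv p = 0"
  shows "degree p = 0"
proof (rule ccontr)
  assume "degree p \<noteq> 0"
  then obtain n where n: "degree p = Suc n" by (cases "degree p") auto
  have "coeff (pderiv p) n = 0" using assms(2) by simp
  then have "coeff p (Suc n) = 0" using nat[of n] by (simp add: coeff_pderiv)
  then show False using n by (metis leading_coeff_0_iff degree_0 nat.distinct(1))
qed

lemma dvd_pderiv_imp_pderiv_eq_0:
  fixes p :: "'a::idom poly"
  assumes "p dvd pderiv p"
  shows "pderiv p = 0"
proof (rule ccontr)
  assume nz: "pderiv p \<noteq> 0"
  have "degree p \<le> degree (pderiv p)"
    using assms nz by (rule dvd_imp_degree_le)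
  moreover have "coeff (pderiv p) n = 0" if "n \<ge> degree p" for n
    using that by (simp add: coeff_pderiv coeff_eq_0)
  ultimately show False using nz leading_coeff_0_iff by blast
qed

text \<open>
  A cofactor \<open>w\<close> of \<open>f\<close> in \<open>partial1 f\<close> has degree \<open>0\<close> in \<open>X2\<close>, so
  comparing leading coefficients in \<open>X2\<close> reduces the claim to the univariate one.
\<close>

lemma dvd_partial1_imp_partial1_eq_0:
  fixes f :: "'r::idom poly poly"
  assumes "f dvd partial1 f"
  shows "partial1 f = 0"
proof (rule ccontr)
  assume nz: "partial1 f \<noteq> 0"
  from assms obtain w where w: "partial1 f = f * w" by (elim dvdE)
  have f0: "f \<noteq> 0" and w0: "w \<noteq> 0" using nz w by auto
  have "degree (partial1 f) \<le> degree f"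
    by (rule degree_le) (simp add: coeff_partial1 coeff_eq_0)
  then have dw: "degree w = 0" using degree_mult_eq[OF f0 w0] w by simp
  have "pderiv (lead_coeff f) = lead_coeff f * lead_coeff w"
    using coeff_mult_degree_sum[of f w] dw w coeff_partial1[of f "degree f"] by simp
  moreover from this have "pderiv (lead_coeff f) = 0"
    by (intro dvd_pderiv_imp_pderiv_eq_0) simp
  ultimately show False using f0 w0 by simp
qed

lemma constant_if_partials_eq_0:
  fixes f :: "'r::idom poly poly"
  assumes nat: "\<And>n. (of_nat (Suc n) :: 'r) \<noteq> 0" and "pderiv f = 0" and "partial1 f = 0"
  shows "f \<in> range const2"
proof -
  have "(of_nat (Suc n) :: 'r poly) \<noteq> 0" for n
    using nat[of n] by (metis of_nat_poly pCons_eq_0_iff)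
  then have "degree f = 0" using assms(2) by (rule degree_eq_0_if_pderiv_eq_0)
  then obtain q where q: "f = [:q:]" by (rule degree_eq_zeroE)
  have "pderiv q = 0" using assms(3) coeff_partial1[of f 0] q by simp
  then have "degree q = 0" using nat by (intro degree_eq_0_if_pderiv_eq_0)
  then obtain r where "q = [:r:]" by (rule degree_eq_zeroE)
  then show ?thesis using q by (auto simp: const2_def)
qed

lemma dvd_const2_imp_const2:
  fixes r :: "'r::idom poly poly"
  assumes "r dvd const2 s" and "s \<noteq> 0"
  shows "r \<in> range const2"
proof -
  have "degree r \<le> degree (const2 s)"
    using assms by (intro dvd_imp_degree_le) (auto simp: const2_eq_0_iff)
  then have "degree r = 0" by (simp add: const2_def)
  then obtain q where q: "r = [:q:]" by (rule degree_eq_zeroE)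
  then have "q dvd [:s:]" using assms(1) by (simp add: const2_def)
  then have "degree q \<le> degree [:s:]" using assms(2) by (intro dvd_imp_degree_le) auto
  then have "degree q = 0" by simp
  then obtain c where "q = [:c:]" by (rule degree_eq_zeroE)
  then show ?thesis using q by (auto simp: const2_def)
qed

text \<open>
  A unique factorization domain carries no canonical \<open>gcd\<close>, so this cancellation rests on the
  arbitrarily chosen greatest common divisor \<open>some_gcd\<close>.
\<close>

lemma coprime_power_dvd_cancel:
  fixes p :: "'a::ufd"
  assumes "coprime p c" and "p dvd c ^ n * g"
  shows "p dvd g"
  using assms(2)
proof (induction n)
  case 0
  then show ?case by simp
next
  case (Suc n)
  then obtain k where "k * p = (c ^ n * g) * c" by (metis dvdE mult.commute power_Suc mult.assoc)
  from some_gcd.coprime_mult_cross_dvd(1)[OF assms(1) this] Suc.IH show ?case by blast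
qed

text \<open>
  The rules build polynomials in the way in which a bound on \<open>D\<^sup>n\<close> is proved by induction.
  Constants are admitted at every \<open>n\<close>, which makes the predicate monotone in \<open>n\<close>.
\<close>

inductive total_degree_le :: "nat \<Rightarrow> 'r::comm_ring_1 poly poly \<Rightarrow> bool" where
  const: "total_degree_le n (const2 r)"
| X1: "total_degree_le n g \<Longrightarrow> total_degree_le (Suc n) (X1 * g)"
| X2: "total_degree_le n g \<Longrightarrow> total_degree_le (Suc n) (X2 * g)"
| add: "total_degree_le n g \<Longrightarrow> total_degree_le n h \<Longrightarrow> total_degree_le n (g + h)"

text \<open>
  For a nonzero polynomial this is the degree of its leading monomial in the lexicographic order with
  \<open>X2\<close> above \<open>X1\<close>. Unlike \<open>degree\<close>, which only sees \<open>X2\<close>, it is positive on each nonconstant linear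
  form, while it still turns products into sums.
\<close>

definition lex_degree :: "'r::idom poly poly \<Rightarrow> nat" where
  "lex_degree g = degree g + degree (lead_coeff g)"

lemma lex_degree_mult:
  assumes "g \<noteq> 0" and "h \<noteq> 0"
  shows "lex_degree (g * h) = lex_degree g + lex_degree h"
proof -
  have "lead_coeff (g * h) = lead_coeff g * lead_coeff h" by (rule lead_coeff_mult)
  then show ?thesis using assms by (simp only: lex_degree_def degree_mult_eq)
      (simp add: degree_mult_eq)
qed

lemma lex_degree_const2_add:
  assumes "lex_degree g > 0"
  shows "lex_degree (const2 c + g) = lex_degree g"
proof (cases "degree g")
  case 0
  then obtain q where q: "g = [:q:]" by (rule degree_eq_zeroE)
  then have "degree q > 0" using assms by (simp add: lex_degree_def)
  then show ?thesis using q by (simp add: lex_degree_def const2_def degree_add_eq_right)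
next
  case (Suc n)
  then have "degree (const2 c) < degree g" by (simp add: const2_def)
  then show ?thesis
    by (simp add: lex_degree_def degree_add_eq_right coeff_eq_0[of "const2 c"])
qed

section \<open>Derivations and their image ideals\<close>

lemma derivation_add: "derivation \<iota> D \<Longrightarrow> D (a + b) = D a + D b"
  and derivation_mult: "derivation \<iota> D \<Longrightarrow> D (a * b) = a * D b + b * D a"
  by (simp_all add: derivation_def)

lemma derivation_0: "derivation \<iota> D \<Longrightarrow> D 0 = 0"
  using derivation_add[of \<iota> D 0 0] by simp

lemma derivation_1: "derivation \<iota> D \<Longrightarrow> D 1 = 0"
  using derivation_mult[of \<iota> D 1 1] by simp

lemma derivation_of_nat: "derivation \<iota> D \<Longrightarrow> D (of_nat n) = 0"
  by (induction n) (simp_all add: derivation_0 derivation_1 derivation_add)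

lemma derivation_const2:
  assumes "derivation const2 D"
  shows "D (const2 r) = 0"
proof -
  have "D (const2 r * 1) = const2 r * D 1" using assms unfolding derivation_def by blast
  then show ?thesis using derivation_1[OF assms] by simp
qed

lemma derivation_minus: "derivation \<iota> D \<Longrightarrow> D (- a) = - D a"
  using derivation_add[of \<iota> D a "- a"] derivation_0[of \<iota> D] by (simp add: eq_neg_iff_add_eq_0 add.commute)

lemma derivation_funpow_0: "derivation \<iota> D \<Longrightarrow> (D ^^ n) 0 = 0"
  by (induction n) (simp_all add: derivation_0)

lemma derivation_funpow_add: "derivation \<iota> D \<Longrightarrow> (D ^^ n) (a + b) = (D ^^ n) a + (D ^^ n) b"
  by (induction n) (simp_all add: derivation_add)

lemma derivation_funpow_kernel_mult:
  assumes "derivation \<iota> D" and "D c = 0"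
  shows "(D ^^ n) (c * g) = c * (D ^^ n) g"
  by (induction n) (simp_all add: derivation_mult[OF assms(1)] assms(2))

text \<open>
  In Leibniz' formula for \<open>D\<^sup>n\<^sup>+\<^sup>1 (x g)\<close> only the terms with at most one derivative on \<open>x\<close> survive.
\<close>

lemma derivation_funpow_mult_linear:
  fixes D :: "'b::comm_ring_1 \<Rightarrow> 'b"
  assumes D: "derivation \<iota> D" and x: "D (D x) = 0"
  shows "(D ^^ Suc n) (x * g) = x * (D ^^ Suc n) g + of_nat (Suc n) * D x * (D ^^ n) g"
proof (induction n)
  case 0
  show ?case by (simp add: derivation_mult[OF D] algebra_simps)
next
  case (Suc n)
  have "(D ^^ Suc (Suc n)) (x * g) =
      D (x * (D ^^ Suc n) g + of_nat (Suc n) * D x * (D ^^ n) g)"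
    using Suc by simp
  also have "\<dots> = x * (D ^^ Suc (Suc n)) g + (1 + of_nat (Suc n)) * D x * (D ^^ Suc n) g"
    by (simp add: derivation_mult[OF D] derivation_add[OF D] x derivation_of_nat[OF D]
        derivation_1[OF D] distrib_left distrib_right mult.commute add.assoc del: of_nat_Suc)
  also have "(1 + of_nat (Suc n) :: 'b) = of_nat (Suc (Suc n))" by simp
  finally show ?case .
qed

lemma derivation_inverse_eq_0:
  assumes D: "derivation \<iota> D" and "D c = 0" and "u * c = 1"
  shows "D u = 0"
proof -
  have "c * D u = 0"
    using derivation_mult[OF D, of u c] derivation_1[OF D] assms(2,3) by simp
  then have "u * c * D u = 0" by (simp add: mult.assoc)
  then show ?thesis using assms(3) by simp
qed

lemma ideal_of_mult: "ideal_of A I \<Longrightarrow> a \<in> A \<Longrightarrow> x \<in> I \<Longrightarrow> a * x \<in> I"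
  and ideal_of_add: "ideal_of A I \<Longrightarrow> x \<in> I \<Longrightarrow> y \<in> I \<Longrightarrow> x + y \<in> I"
  and ideal_of_subset: "ideal_of A I \<Longrightarrow> I \<subseteq> A"
  by (auto simp: ideal_of_def)

lemma ideal_of_Ker_Ker:
  assumes "derivation \<iota> D"
  shows "ideal_of (Ker D) (Ker D)"
  by (simp add: ideal_of_def Ker_def derivation_0[OF assms] derivation_add[OF assms]
      derivation_mult[OF assms])

lemma ideal_of_hull:
  assumes "ideal_of A A" and "S \<subseteq> A"
  shows "ideal_of A (ideal_of A hull S)"
proof -
  have "ideal_of A hull S \<subseteq> A" using assms by (intro hull_minimal)
  then show ?thesis by (auto simp: ideal_of_def hull_def)
qed

lemma ideal_of_ideal_power:
  assumes A: "ideal_of A A" and I: "I \<subseteq> A"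
  shows "ideal_of A (ideal_power A I n)"
proof (induction n)
  case 0
  then show ?case using A by simp
next
  case (Suc n)
  then have "{x * y | x y. x \<in> I \<and> y \<in> ideal_power A I n} \<subseteq> A"
    using I ideal_of_subset[OF Suc] ideal_of_mult[OF A] by blast
  then show ?case using A by (simp add: ideal_product_def ideal_of_hull)
qed

lemma mult_mem_ideal_power_Suc:
  "x \<in> I \<Longrightarrow> y \<in> ideal_power A I n \<Longrightarrow> x * y \<in> ideal_power A I (Suc n)"
  by (auto simp: ideal_product_def intro!: hull_inc)

lemma ideal_of_image_ideal:
  assumes D: "derivation \<iota> D"
  shows "ideal_of (Ker D) (image_ideal D n)"
  unfolding ideal_of_def
proof (intro conjI ballI)
  show "image_ideal D n \<subseteq> Ker D" by (auto simp: image_ideal_def)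
  show "0 \<in> image_ideal D n"
    by (auto simp: image_ideal_def Ker_def derivation_0[OF D]
        intro!: range_eqI[where x = 0] derivation_funpow_0[OF D, symmetric])
next
  fix x y assume "x \<in> image_ideal D n" "y \<in> image_ideal D n"
  then show "x + y \<in> image_ideal D n"
    by (auto simp: image_ideal_def Ker_def derivation_add[OF D]
        derivation_funpow_add[OF D, symmetric])
next
  fix a x assume "a \<in> Ker D" "x \<in> image_ideal D n"
  then show "a * x \<in> image_ideal D n"
    by (auto simp: image_ideal_def Ker_def derivation_mult[OF D]
        derivation_funpow_kernel_mult[OF D, symmetric])
qed

text \<open>
  If \<open>y = D\<^sup>n g\<close> is in the kernel, then \<open>D\<^sup>n\<^sup>+\<^sup>1 (x g) = (n + 1) D x y\<close>, and the inverse of \<open>n + 1\<close> can be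
  moved under \<open>D\<^sup>n\<^sup>+\<^sup>1\<close> because it is itself in the kernel.
\<close>

lemma slope_mult_image_ideal:
  fixes D :: "'b::comm_ring_1 \<Rightarrow> 'b"
  assumes D: "derivation \<iota> D" and x: "D (D x) = 0"
    and nat: "(of_nat (Suc n) :: 'b) dvd 1"
    and y: "y \<in> image_ideal D n"
  shows "D x * y \<in> image_ideal D (Suc n)"
proof -
  from nat obtain u where u: "u * of_nat (Suc n) = (1::'b)"
    by (metis dvdE mult.commute)
  have Du: "D u = 0"
    using D derivation_of_nat[OF D] u by (rule derivation_inverse_eq_0)
  from y obtain g where Dy: "D y = 0" and g: "y = (D ^^ n) g"
    by (auto simp: image_ideal_def Ker_def)
  have "(D ^^ Suc n) (x * g) = of_nat (Suc n) * D x * y"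
    using derivation_funpow_mult_linear[OF D x, of n g] Dy g by simp
  then have "(D ^^ Suc n) (u * (x * g)) = (u * of_nat (Suc n)) * (D x * y)"
    by (simp only: derivation_funpow_kernel_mult[OF D Du] mult.assoc)
  then have "D x * y = (D ^^ Suc n) (u * (x * g))" using u by simp
  moreover have "D (D x * y) = 0" by (simp add: derivation_mult[OF D] x Dy)
  ultimately show ?thesis by (auto simp: image_ideal_def Ker_def simp del: funpow.simps)
qed

text \<open>
  The elements that multiply the \<open>n\<close>-th image ideal into the next one form an ideal of the kernel, so
  it is enough to look at the generators \<open>D x\<close>, and \<open>slope_mult_image_ideal\<close> handles these.
\<close>

lemma ideal_power_subset_image_ideal:
  fixes D :: "'b::comm_ring_1 \<Rightarrow> 'b"
  assumes D: "derivation \<iota> D" and S: "\<And>x. x \<in> S \<Longrightarrow> D (D x) = 0"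
    and nat: "\<And>n. (of_nat (Suc n) :: 'b) dvd 1"
  shows "ideal_power (Ker D) (ideal_of (Ker D) hull (D ` S)) n \<subseteq> image_ideal D n"
proof (induction n)
  case 0
  show ?case by (simp add: image_ideal_def)
next
  case (Suc n)
  note ideal = ideal_of_image_ideal[OF D]
  let ?T = "{x \<in> Ker D. \<forall>y \<in> image_ideal D n. x * y \<in> image_ideal D (Suc n)}"
  have "ideal_of (Ker D) ?T"
    using ideal_of_Ker_Ker[OF D] ideal[of "Suc n"]
    unfolding ideal_of_def by (auto simp: distrib_right mult.assoc)
  moreover have "D ` S \<subseteq> ?T"
    using slope_mult_image_ideal[OF D S nat] S by (auto simp: Ker_def)
  ultimately have "ideal_of (Ker D) hull (D ` S) \<subseteq> ?T" by (intro hull_minimal)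
  then show ?case
    unfolding ideal_power.simps ideal_product_def
    using Suc ideal by (intro hull_minimal) blast+
qed

section \<open>Derivations with constant coefficients\<close>

lemma derivation_eq_partials:
  fixes D :: "'r::idom poly poly \<Rightarrow> 'r poly poly"
  assumes D: "derivation const2 D"
  shows "D g = D X1 * partial1 g + D X2 * pderiv g"
proof (induction g rule: poly2_induct)
  case (const r)
  then show ?case
    by (simp add: derivation_const2[OF D] partial1_const2) (simp add: const2_def)
next
  case (X1 g)
  have "pderiv (X1 * g) = X1 * pderiv g" by (simp add: X1_mult_eq pderiv_smult)
  then show ?case using X1
    by (simp add: derivation_mult[OF D] partial1_X1_mult algebra_simps)
next
  case (X2 g)
  have "pderiv (X2 * g) = g + X2 * pderiv g"
    by (simp add: X2_mult_eq pderiv_pCons)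
  then show ?case using X2
    by (simp add: derivation_mult[OF D] partial1_X2_mult algebra_simps)
next
  case (add g h)
  then show ?case
    by (simp add: derivation_add[OF D] partial1_add pderiv_add algebra_simps)
qed

text \<open>
  By \<open>derivation_eq_partials\<close> a common divisor of the two slopes divides all values of \<open>D\<close>.
\<close>

lemma coprime_slopes:
  fixes D :: "'r::idom poly poly \<Rightarrow> 'r poly poly"
  assumes D: "derivation const2 D" and irr: "irreducible_derivation D"
  shows "coprime (D X1) (D X2)"
proof (rule coprimeI)
  fix r assume r: "r dvd D X1" "r dvd D X2"
  have "r dvd D g" for g
    using r by (subst derivation_eq_partials[OF D]) (intro dvd_add dvd_mult2)
  then have "range D \<subseteq> range ((*) r)" by (auto elim!: dvdE)
  then show "r dvd 1" using irr by (auto simp: irreducible_derivation_def)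
qed

text \<open>
  Each of the equations \<open>D (D X1) = 0\<close> and \<open>D (D X2) = 0\<close> equates a multiple of one slope with a
  multiple of the other. By coprimality \<open>D X1\<close> divides its own \<open>X2\<close>-derivative and \<open>D X2\<close> its own
  \<open>X1\<close>-derivative, which is impossible by degree unless these vanish. The equations then lose a term
  and force the remaining partial derivatives to vanish as well.
\<close>

lemma slopes_constant:
  fixes D :: "'r::ufd poly poly \<Rightarrow> 'r poly poly"
  assumes D: "derivation const2 D" and irr: "irreducible_derivation D"
    and nat: "\<And>n. (of_nat (Suc n) :: 'r) \<noteq> 0"
    and DD: "D (D X1) = 0" "D (D X2) = 0"
  shows "D X1 \<in> range const2" "D X2 \<in> range const2"
proof -
  let ?f = "D X1" and ?g = "D X2"
  have zero: "(0 :: 'r poly poly) \<in> range const2" by (metis const2_0 rangeI)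
  have cop: "coprime ?f ?g" using D irr by (rule coprime_slopes)
  note eq = DD(1)[unfolded derivation_eq_partials[OF D, of ?f]]
    DD(2)[unfolded derivation_eq_partials[OF D, of ?g]]
  have "(- partial1 ?f) * ?f = pderiv ?f * ?g"
    using eq(1) by (simp add: mult.commute minus_unique)
  from some_gcd.coprime_mult_cross_dvd(1)[OF cop this] have p: "pderiv ?f = 0"
    by (rule dvd_pderiv_imp_pderiv_eq_0)
  then have "?f = 0 \<or> partial1 ?f = 0" using eq(1) by simp
  then show "?f \<in> range const2"
    using zero constant_if_partials_eq_0[OF nat p] by auto
  have "partial1 ?g * ?f = (- pderiv ?g) * ?g"
    using eq(2) by (simp add: mult.commute eq_neg_iff_add_eq_0)
  from some_gcd.coprime_mult_cross_dvd(2)[OF cop this] have p: "partial1 ?g = 0"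
    by (rule dvd_partial1_imp_partial1_eq_0)
  then have "?g = 0 \<or> pderiv ?g = 0" using eq(2) by simp
  then show "?g \<in> range const2"
    using zero constant_if_partials_eq_0[OF nat _ p] by auto
qed

lemma monom_Suc_dvd_linear_mult:
  fixes q :: "'a::comm_ring_1 poly"
  assumes "monom 1 n dvd q"
  shows "monom 1 (Suc n) dvd [:0, c:] * q"
proof -
  from assms obtain k where q: "q = monom 1 n * k" by (elim dvdE)
  have "[:0, c:] * monom 1 n = monom 1 (Suc n) * [:c:]"
    by (simp add: monom_Suc mult.commute smult_monom)
  then have "[:0, c:] * q = monom 1 (Suc n) * ([:c:] * k)"
    unfolding q by (metis mult.assoc)
  then show ?thesis by (rule dvdI)
qed

locale constant_coefficient_derivation =
  fixes D :: "'r::ufd poly poly \<Rightarrow> 'r poly poly" and a b :: 'r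
  assumes D: "derivation const2 D"
    and D_X1: "D X1 = const2 a" and D_X2: "D X2 = const2 b"
    and coprime: "coprime a b"
    and of_nat_Suc_nonzero: "\<And>n. (of_nat (Suc n) :: 'r) \<noteq> 0"
begin

text \<open>
  The homomorphism \<open>X1 \<mapsto> a t, X2 \<mapsto> b t\<close>. The line is the integral curve of the vector field
  \<open>a \<partial>\<^sub>1 + b \<partial>\<^sub>2\<close> through the origin, so that \<open>D\<close> restricts to \<open>d/dt\<close> on it (\<open>restrict_line_D\<close>), and the
  powers of \<open>t\<close> in the image record the homogeneous components.
\<close>

definition restrict_line :: "'r poly poly \<Rightarrow> 'r poly" where
  "restrict_line g = poly (map_poly (\<lambda>q. pcompose q [:0, a:]) g) [:0, b:]"

lemma restrict_line_pCons:
  "restrict_line (pCons q g) = pcompose q [:0, a:] + [:0, b:] * restrict_line g"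
  by (cases "pCons q g = 0") (auto simp: restrict_line_def map_poly_pCons)

lemma restrict_line_0: "restrict_line 0 = 0"
  by (simp add: restrict_line_def)

lemma restrict_line_add: "restrict_line (g + h) = restrict_line g + restrict_line h"
proof (induction g arbitrary: h)
  case (pCons q g)
  then show ?case
    by (cases h) (simp add: restrict_line_pCons pcompose_add algebra_simps)
qed (simp add: restrict_line_0)

lemma restrict_line_smult: "restrict_line (smult q g) = pcompose q [:0, a:] * restrict_line g"
  by (induction g) (simp_all add: restrict_line_0 restrict_line_pCons pcompose_mult algebra_simps)

lemma restrict_line_mult: "restrict_line (g * h) = restrict_line g * restrict_line h"
proof (induction g)
  case (pCons q g)
  have "pCons q g * h = smult q h + pCons 0 (g * h)" by simp
  then show ?case
    by (simp only: restrict_line_add restrict_line_smult restrict_line_pCons pCons)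
      (simp add: algebra_simps)
qed (simp add: restrict_line_0)

lemma restrict_line_single: "restrict_line [:q:] = pcompose q [:0, a:]"
  by (simp add: restrict_line_pCons restrict_line_0)

lemma restrict_line_const2: "restrict_line (const2 r) = [:r:]"
  and restrict_line_X1: "restrict_line X1 = [:0, a:]"
  and restrict_line_X2: "restrict_line X2 = [:0, b:]"
  by (simp_all add: const2_def X1_def X2_def restrict_line_single restrict_line_pCons[of 0]
      restrict_line_single[of 1, simplified] pcompose_pCons pcompose_1)

lemma restrict_line_D: "restrict_line (D g) = pderiv (restrict_line g)"
proof (induction g rule: poly2_induct)
  case (const r)
  then show ?case by (simp add: derivation_const2[OF D] restrict_line_0 restrict_line_const2)
next
  case (X1 g)
  then show ?case
    by (simp add: derivation_mult[OF D] D_X1 restrict_line_add restrict_line_mult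
        restrict_line_X1 restrict_line_const2 pderiv_pCons pderiv_smult pderiv_add algebra_simps)
next
  case (X2 g)
  then show ?case
    by (simp add: derivation_mult[OF D] D_X2 restrict_line_add restrict_line_mult
        restrict_line_X2 restrict_line_const2 pderiv_pCons pderiv_smult pderiv_add algebra_simps)
next
  case (add g h)
  then show ?case by (simp add: derivation_add[OF D] restrict_line_add pderiv_add)
qed

lemma restrict_line_funpow_D: "restrict_line ((D ^^ n) g) = (pderiv ^^ n) (restrict_line g)"
  by (induction n) (simp_all add: restrict_line_D)

lemma coeff_eq_0_if_funpow_pderiv_eq_0:
  assumes "(pderiv ^^ n) (p :: 'r poly) = 0"
  shows "coeff p (m + n) = 0"
  using assms
proof (induction n arbitrary: p m)
  case (Suc n)
  then have "coeff (pderiv p) (m + n) = 0" by (simp add: funpow_Suc_right del: funpow.simps)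
  then show ?case using of_nat_Suc_nonzero[of "m + n"] by (simp add: coeff_pderiv del: of_nat_Suc)
qed simp

definition line_form :: "'r poly poly" where
  "line_form = const2 b * X1 - const2 a * X2"

lemma line_form_eq: "line_form = [:[:0, b:], [:- a:]:]"
  by (simp add: line_form_def const2_def X1_def X2_def)

lemma D_line_form: "D line_form = 0"
proof -
  have "D line_form = D (const2 b * X1) + D (- (const2 a * X2))"
    by (simp add: line_form_def derivation_add[OF D, symmetric])
  then show ?thesis
    by (simp add: derivation_minus[OF D] derivation_mult[OF D] derivation_const2[OF D]
        D_X1 D_X2 mult.commute)
qed

lemma restrict_line_line_form: "restrict_line line_form = 0"
  by (simp add: line_form_eq restrict_line_pCons restrict_line_0 pcompose_pCons mult.commute)

lemma lex_degree_line_form: "lex_degree line_form = 1"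
proof (cases "a = 0")
  case True
  then have "b \<noteq> 0" using coprime by auto
  moreover have "line_form = [:[:0, b:]:]" using line_form_eq True by simp
  ultimately show ?thesis by (simp add: lex_degree_def)
qed (simp add: line_form_eq lex_degree_def)

lemma line_form_nonzero: "line_form \<noteq> 0"
  using lex_degree_line_form by (auto simp: lex_degree_def)

text \<open>
  A common divisor is a constant because \<open>a \<noteq> 0\<close>; it divides both coefficients of the form.
\<close>

lemma coprime_line_form_const2:
  assumes "a \<noteq> 0"
  shows "coprime line_form (const2 a)"
proof (rule coprimeI)
  fix r assume r: "r dvd line_form" "r dvd const2 a"
  then obtain c where c: "r = const2 c" using dvd_const2_imp_const2 assms by blast
  have ca: "c dvd a" using r(2) by (simp add: c const2_dvd_const2_iff)
  have "[:c:] dvd [:0, b:]"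
    using r(1) unfolding c line_form_eq const2_def by (auto simp: const_poly_dvd_iff dest: spec[of _ 0])
  then have "c dvd b" by (auto simp: const_poly_dvd_iff dest: spec[of _ 1])
  then show "r dvd 1" using ca coprime by (auto simp: c const2_dvd_1_iff elim: coprimeE)
qed

text \<open>
  Modulo the form, \<open>a X2\<close> equals \<open>b X1\<close>; enough factors \<open>a\<close> trade every \<open>X2\<close> for an \<open>X1\<close>.
\<close>

lemma eliminate_X2_mod_line_form:
  "\<exists>n h q. const2 a ^ n * g = line_form * h + [:q:]"
proof (induction g rule: poly2_induct)
  case (const r)
  have "const2 a ^ 0 * const2 r = line_form * 0 + [:[:r:]:]" by (simp add: const2_def)
  then show ?case by blast
next
  case (X1 g)
  then obtain n h q where "const2 a ^ n * g = line_form * h + [:q:]" by blast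
  then have "const2 a ^ n * (X1 * g) = X1 * (line_form * h + [:q:])" by (metis mult.left_commute)
  then have "const2 a ^ n * (X1 * g) = line_form * (X1 * h) + [:[:0, 1:] * q:]"
    by (simp add: algebra_simps) (simp add: X1_def)
  then show ?case by blast
next
  case (X2 g)
  then obtain n h q where "const2 a ^ n * g = line_form * h + [:q:]" by blast
  then have "const2 a ^ Suc n * (X2 * g) = const2 a * X2 * (line_form * h + [:q:])"
    by (metis (no_types, opaque_lifting) mult.assoc mult.commute power_Suc)
  also have "\<dots> = line_form * (const2 a * X2 * h - [:q:]) + const2 b * X1 * [:q:]"
    by (simp add: line_form_def algebra_simps)
  also have "const2 b * X1 * [:q:] = [:[:0, b:] * q:]" by (simp add: const2_def X1_def)
  finally show ?case by blast
next
  case (add g g')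
  then obtain n h q n' h' q'
    where g: "const2 a ^ n * g = line_form * h + [:q:]"
      and g': "const2 a ^ n' * g' = line_form * h' + [:q':]" by blast
  have s: "const2 a ^ m * [:q:] = [:[:a:] ^ m * q:]" for m q
    by (induction m) (simp_all only: power_Suc mult.assoc, simp_all add: const2_def)
  have "const2 a ^ (n + n') * (g + g') =
      const2 a ^ n' * (const2 a ^ n * g) + const2 a ^ n * (const2 a ^ n' * g')"
    by (simp add: algebra_simps power_add)
  also have "\<dots> = line_form * (const2 a ^ n' * h + const2 a ^ n * h') +
      (const2 a ^ n' * [:q:] + const2 a ^ n * [:q':])"
    unfolding g g' by (simp add: algebra_simps)
  also have "const2 a ^ n' * [:q:] + const2 a ^ n * [:q':] = [:[:a:] ^ n' * q + [:a:] ^ n * q':]"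
    by (simp only: s) simp
  finally show ?case by blast
qed

text \<open>
  The kernel of the restriction. For \<open>a \<noteq> 0\<close>, a power of \<open>a\<close> times \<open>g\<close> is a multiple of the form plus a
  polynomial in \<open>X1\<close> alone; the restriction to the line is injective on the latter, and the power of \<open>a\<close>
  cancels by coprimality. For \<open>a = 0\<close>, coprimality makes \<open>b\<close> a unit, so the form is \<open>X1\<close> up to a unit.
\<close>

lemma line_form_dvd_if_restrict_line_eq_0:
  assumes g: "restrict_line g = 0"
  shows "line_form dvd g"
proof (cases "a = 0")
  case False
  obtain n h q where h: "const2 a ^ n * g = line_form * h + [:q:]"
    using eliminate_X2_mod_line_form by blast
  have "restrict_line (const2 a ^ n * g) = 0" using g by (simp add: restrict_line_mult)
  then have "pcompose q [:0, a:] = 0"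
    unfolding h by (simp add: restrict_line_add restrict_line_mult restrict_line_line_form
        restrict_line_single)
  then have "q = 0" using False by (intro pcompose_eq_0[of q "[:0, a:]"]) auto
  then have "line_form dvd const2 a ^ n * g" using h by simp
  then show ?thesis using coprime_line_form_const2[OF False] coprime_power_dvd_cancel by blast
next
  case True
  then have b: "b dvd 1" using coprime by simp
  have "\<exists>h q. g = X1 * h + map_poly (\<lambda>r. [:r:]) q" for g :: "'r poly poly"
  proof (induction g)
    case 0
    have "(0 :: 'r poly poly) = X1 * 0 + map_poly (\<lambda>r. [:r:]) 0" by simp
    then show ?case by blast
  next
    case (pCons p g)
    then obtain h q where g: "g = X1 * h + map_poly (\<lambda>r. [:r:]) q" by blast
    obtain r p' where p: "p = pCons r p'" by (cases p)
    have "map_poly (\<lambda>r. [:r:]) (pCons r q) = pCons [:r:] (map_poly (\<lambda>r. [:r:]) q)"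
      by (cases "pCons r q = 0") (auto simp: map_poly_pCons)
    then have "pCons p g = X1 * pCons p' h + map_poly (\<lambda>r. [:r:]) (pCons r q)"
      by (simp only: g p X1_mult_eq) simp
    then show ?case by blast
  qed
  then obtain h q where h: "g = X1 * h + map_poly (\<lambda>r. [:r:]) q" by blast
  have "restrict_line (map_poly (\<lambda>r. [:r:]) q) = pcompose q [:0, b:]"
    by (induction q) (simp_all add: restrict_line_0 restrict_line_pCons map_poly_pCons pcompose_pCons)
  moreover have "restrict_line (X1 * h) = 0"
    unfolding restrict_line_mult restrict_line_X1 using True by simp
  ultimately have "pcompose q [:0, b:] = 0" using g h by (simp add: restrict_line_add)
  moreover have "b \<noteq> 0" using b by auto
  ultimately have "q = 0" by (intro pcompose_eq_0[of q "[:0, b:]"]) auto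
  then have "X1 dvd g" using h by simp
  moreover have "line_form dvd X1"
  proof -
    from b obtain k where "b * k = 1" by (metis dvdE)
    then have "const2 b * const2 k = 1" by (metis const2_mult const2_1)
    then have "X1 = const2 b * X1 * const2 k"
      by (metis mult.assoc mult.commute mult_1)
    moreover have "line_form = const2 b * X1" using line_form_def by (simp add: True const2_0)
    ultimately show ?thesis by (metis dvd_triv_left)
  qed
  ultimately show ?thesis using dvd_trans by blast
qed

text \<open>
  The part \<open>h\<close> collects the terms of total degree above \<open>n\<close>, but only the order of vanishing of its
  restriction matters later; stating just this avoids homogeneous components.
\<close>

lemma total_degree_split:
  "\<exists>p h. g = p + h \<and> total_degree_le n p \<and> monom 1 (Suc n) dvd restrict_line h"
proof (induction g arbitrary: n rule: poly2_induct)
  case (const r)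
  have "const2 r = const2 r + 0 \<and> total_degree_le n (const2 r) \<and>
      monom 1 (Suc n) dvd restrict_line 0"
    by (simp add: total_degree_le.const restrict_line_0)
  then show ?case by blast
next
  case (X1 g)
  show ?case
  proof (cases n)
    case 0
    have "monom 1 (Suc 0) dvd [:0, a:] * restrict_line g"
      by (rule monom_Suc_dvd_linear_mult) simp
    then have "X1 * g = const2 0 + X1 * g \<and> total_degree_le n (const2 0) \<and>
        monom 1 (Suc n) dvd restrict_line (X1 * g)"
      by (simp add: 0 const2_0 total_degree_le.const[of _ 0, unfolded const2_0]
          restrict_line_mult restrict_line_X1)
    then show ?thesis by blast
  next
    case (Suc m)
    obtain p h where g: "g = p + h" and p: "total_degree_le m p"
      and h: "monom 1 (Suc m) dvd restrict_line h"
      using X1.IH[of m] by blast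
    have "X1 * g = X1 * p + X1 * h" by (simp add: g distrib_left)
    moreover have "total_degree_le n (X1 * p)" unfolding Suc using p by (rule total_degree_le.X1)
    moreover have "monom 1 (Suc n) dvd restrict_line (X1 * h)"
      unfolding Suc restrict_line_mult restrict_line_X1 using h by (rule monom_Suc_dvd_linear_mult)
    ultimately show ?thesis by blast
  qed
next
  case (X2 g)
  show ?case
  proof (cases n)
    case 0
    have "monom 1 (Suc 0) dvd [:0, b:] * restrict_line g"
      by (rule monom_Suc_dvd_linear_mult) simp
    then have "X2 * g = const2 0 + X2 * g \<and> total_degree_le n (const2 0) \<and>
        monom 1 (Suc n) dvd restrict_line (X2 * g)"
      by (simp add: 0 const2_0 total_degree_le.const[of _ 0, unfolded const2_0]
          restrict_line_mult restrict_line_X2)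
    then show ?thesis by blast
  next
    case (Suc m)
    obtain p h where g: "g = p + h" and p: "total_degree_le m p"
      and h: "monom 1 (Suc m) dvd restrict_line h"
      using X2.IH[of m] by blast
    have "X2 * g = X2 * p + X2 * h" by (simp add: g distrib_left)
    moreover have "total_degree_le n (X2 * p)" unfolding Suc using p by (rule total_degree_le.X2)
    moreover have "monom 1 (Suc n) dvd restrict_line (X2 * h)"
      unfolding Suc restrict_line_mult restrict_line_X2 using h by (rule monom_Suc_dvd_linear_mult)
    ultimately show ?thesis by blast
  qed
next
  case (add g g')
  obtain p h p' h' where "g = p + h" "g' = p' + h'"
    and p: "total_degree_le n p" "total_degree_le n p'"
    and h: "monom 1 (Suc n) dvd restrict_line h" "monom 1 (Suc n) dvd restrict_line h'"
    using add.IH[of n] by blast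
  then have "g + g' = (p + p') + (h + h')" by simp
  moreover have "total_degree_le n (p + p')" using p by (rule total_degree_le.add)
  moreover have "monom 1 (Suc n) dvd restrict_line (h + h')"
    unfolding restrict_line_add using h by (rule dvd_add)
  ultimately show ?case by blast
qed

lemma degree_restrict_line_le: "total_degree_le n p \<Longrightarrow> degree (restrict_line p) \<le> n"
proof (induction rule: total_degree_le.induct)
  case (const n r)
  then show ?case by (simp add: restrict_line_const2)
next
  case (X1 n g)
  have "degree ([:0, a:] * restrict_line g) \<le> degree [:0, a:] + degree (restrict_line g)"
    by (rule degree_mult_le)
  also have "\<dots> \<le> 1 + n" using X1.IH by (intro add_mono) (auto simp: degree_pCons_eq_if)
  finally show ?case by (simp only: restrict_line_mult restrict_line_X1 plus_1_eq_Suc)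
next
  case (X2 n g)
  have "degree ([:0, b:] * restrict_line g) \<le> degree [:0, b:] + degree (restrict_line g)"
    by (rule degree_mult_le)
  also have "\<dots> \<le> 1 + n" using X2.IH by (intro add_mono) (auto simp: degree_pCons_eq_if)
  finally show ?case by (simp only: restrict_line_mult restrict_line_X2 plus_1_eq_Suc)
next
  case (add n g h)
  then show ?case unfolding restrict_line_add by (intro degree_add_le)
qed

abbreviation slope_ideal :: "'r poly poly set" where
  "slope_ideal \<equiv> ideal_of (Ker D) hull {D X1, D X2}"

lemma slopes_subset_Ker: "{D X1, D X2} \<subseteq> Ker D"
  by (simp add: Ker_def D_X1 D_X2 derivation_const2[OF D])

lemma ideal_of_slope_ideal_power: "ideal_of (Ker D) (ideal_power (Ker D) slope_ideal n)"
  using ideal_of_Ker_Ker[OF D] hull_minimal[OF slopes_subset_Ker]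
  by (intro ideal_of_ideal_power) blast+

lemma funpow_D_linear_mult:
  assumes x: "D x \<in> {D X1, D X2}"
    and g: "(D ^^ n) g \<in> ideal_power (Ker D) slope_ideal n \<inter> range const2"
  shows "(D ^^ Suc n) (x * g) \<in> ideal_power (Ker D) slope_ideal (Suc n) \<inter> range const2"
proof -
  from g obtain r where r: "(D ^^ n) g = const2 r" by auto
  from x obtain s where s: "D x = const2 s" using D_X1 D_X2 by auto
  have "D (D x) = 0" "(D ^^ Suc n) g = 0"
    by (simp_all add: r s derivation_const2[OF D])
  then have eq: "(D ^^ Suc n) (x * g) = of_nat (Suc n) * (D x * (D ^^ n) g)"
    using derivation_funpow_mult_linear[OF D, of x n g] by (simp add: mult.assoc)
  have "D x * (D ^^ n) g \<in> ideal_power (Ker D) slope_ideal (Suc n)"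
    using x g by (intro mult_mem_ideal_power_Suc) (auto intro: hull_inc)
  moreover have "of_nat (Suc n) \<in> Ker D"
    by (simp only: Ker_def mem_Collect_eq derivation_of_nat[OF D])
  ultimately have "(D ^^ Suc n) (x * g) \<in> ideal_power (Ker D) slope_ideal (Suc n)"
    unfolding eq by (rule ideal_of_mult[OF ideal_of_slope_ideal_power, rotated])
  moreover have "(D ^^ Suc n) (x * g) = const2 (of_nat (Suc n) * (s * r))"
    unfolding eq r s by (simp only: const2_mult const2_of_nat)
  ultimately show ?thesis by simp
qed

text \<open>
  On terms of degree exactly \<open>n\<close>, \<open>D\<^sup>n\<close> acts by \<open>X\<^sub>1\<^sup>i X\<^sub>2\<^sup>n\<^sup>-\<^sup>i \<mapsto> n! a\<^sup>i b\<^sup>n\<^sup>-\<^sup>i\<close>, and it kills those of lower degree.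
  That the value is a constant is proved along with the membership: the induction step needs
  \<open>D\<^sup>n\<^sup>+\<^sup>1 g = 0\<close>.
\<close>

lemma funpow_D_total_degree_le:
  "total_degree_le n p \<Longrightarrow> (D ^^ n) p \<in> ideal_power (Ker D) slope_ideal n \<inter> range const2"
proof (induction rule: total_degree_le.induct)
  case (const n r)
  show ?case
  proof (cases n)
    case 0
    then show ?thesis by (simp add: Ker_def derivation_const2[OF D])
  next
    case (Suc m)
    then have "(D ^^ n) (const2 r) = const2 0"
      by (simp add: funpow_Suc_right derivation_const2[OF D] derivation_funpow_0[OF D] const2_0
          del: funpow.simps)
    moreover have "const2 0 \<in> ideal_power (Ker D) slope_ideal n"
      using ideal_of_slope_ideal_power[of n] by (simp add: ideal_of_def const2_0)
    ultimately show ?thesis by simp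
  qed
next
  case (X1 n g)
  then show ?case by (intro funpow_D_linear_mult) (auto simp: D_X1)
next
  case (X2 n g)
  then show ?case by (intro funpow_D_linear_mult) (auto simp: D_X2)
next
  case (add n g h)
  then show ?case
    using ideal_of_add[OF ideal_of_slope_ideal_power]
    by (auto simp: derivation_funpow_add[OF D] const2_add[symmetric])
qed

text \<open>
  The induction is on the degree of the element \<open>u\<close> of the image ideal, not of its preimage \<open>g\<close>: in
  \<open>u = c + F v\<close> with a constant \<open>c\<close>, the degree of \<open>v\<close> is visibly smaller, whereas nothing is known about
  the quotient \<open>h'\<close> of the chosen \<open>h\<close>.
\<close>

lemma image_ideal_subset: "u \<in> image_ideal D n \<Longrightarrow> u \<in> ideal_power (Ker D) slope_ideal n"
proof (induction u rule: measure_induct_rule[where f = lex_degree])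
  case (less u)
  note ideal = ideal_of_slope_ideal_power[of n]
  from less.prems obtain g where Du: "D u = 0" and u: "u = (D ^^ n) g"
    by (auto simp: image_ideal_def Ker_def)
  obtain p h where g: "g = p + h" and p: "total_degree_le n p"
    and h: "monom 1 (Suc n) dvd restrict_line h"
    using total_degree_split[of g n] by blast
  have "restrict_line h = 0"
  proof (rule poly_eqI)
    fix i
    show "coeff (restrict_line h) i = coeff 0 i"
    proof (cases "i < Suc n")
      case True
      then show ?thesis using h by (auto simp: coeff_monom_mult elim!: dvdE)
    next
      case False
      have "(pderiv ^^ Suc n) (restrict_line g) = 0"
        using Du u by (simp add: restrict_line_funpow_D[symmetric] restrict_line_D[symmetric]
            restrict_line_0)
      from coeff_eq_0_if_funpow_pderiv_eq_0[OF this, of "i - Suc n"] False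
      have "coeff (restrict_line g) i = 0" by simp
      moreover have "coeff (restrict_line p) i = 0"
        using degree_restrict_line_le[OF p] False by (intro coeff_eq_0) simp
      ultimately show ?thesis by (simp add: g restrict_line_add)
    qed
  qed
  then obtain h' where h': "h = line_form * h'"
    using line_form_dvd_if_restrict_line_eq_0 by (metis dvdE)
  define v where "v = (D ^^ n) h'"
  from funpow_D_total_degree_le[OF p] obtain c
    where c: "(D ^^ n) p = const2 c" "const2 c \<in> ideal_power (Ker D) slope_ideal n" by auto
  have uv: "u = const2 c + line_form * v"
    by (simp add: u g h' v_def c derivation_funpow_add[OF D]
        derivation_funpow_kernel_mult[OF D D_line_form])
  show ?case
  proof (cases "v = 0")
    case True
    then show ?thesis using uv c by simp
  next
    case False
    have "line_form * D v = 0"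
      using Du by (simp add: uv derivation_add[OF D] derivation_const2[OF D]
          derivation_mult[OF D] D_line_form)
    then have "v \<in> image_ideal D n"
      using line_form_nonzero by (simp add: image_ideal_def Ker_def v_def)
    moreover have "lex_degree u = Suc (lex_degree v)"
      using lex_degree_mult[OF line_form_nonzero False]
      by (simp add: uv lex_degree_const2_add lex_degree_line_form)
    ultimately have "v \<in> ideal_power (Ker D) slope_ideal n" using less.IH by simp
    moreover have "line_form \<in> Ker D" using D_line_form by (simp add: Ker_def)
    ultimately show ?thesis
      unfolding uv using c ideal_of_add[OF ideal] ideal_of_mult[OF ideal] by blast
  qed
qed

end

section \<open>The image ideals are powers of the ideal of slopes\<close>

theorem theorem4p1:
  fixes \<iota> :: "'k::field_char_0 \<Rightarrow> 'r::ufd"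
    and D :: "'r poly poly \<Rightarrow> 'r poly poly"
    and j :: nat
  assumes "finitely_generated_algebra \<iota>"
    and "locally_nilpotent_derivation const2 D"
    and "irreducible_derivation D"
    and "(D ^^ 2) X1 = 0" and "(D ^^ 2) X2 = 0"
  shows "image_ideal D j = ideal_power (Ker D) (ideal_of (Ker D) hull {D X1, D X2}) j"
proof -
  have D: "derivation const2 D"
    using assms(2) by (simp add: locally_nilpotent_derivation_def)
  interpret \<iota>: comm_ring_hom \<iota>
    using assms(1) by (simp add: finitely_generated_algebra_def)
  \<comment> \<open>The field \<open>k\<close> enters only here: its inverses of positive integers are transported to \<open>R\<close>.\<close>
  have unit: "(of_nat (Suc n) :: 'r) dvd 1" for n
  proof
    have "\<iota> (of_nat (Suc n) * inverse (of_nat (Suc n))) = 1"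
      by (simp del: of_nat_Suc \<iota>.hom_mult)
    then show "1 = of_nat (Suc n) * \<iota> (inverse (of_nat (Suc n)))"
      by (simp only: \<iota>.hom_mult \<iota>.hom_of_nat)
  qed
  have DD: "D (D X1) = 0" "D (D X2) = 0"
    using assms(4,5) by (simp_all add: numeral_2_eq_2)
  have nat: "(of_nat (Suc n) :: 'r) \<noteq> 0" for n
    using unit[of n] by (metis dvd_0_left_iff zero_neq_one)
  obtain a b where ab: "D X1 = const2 a" "D X2 = const2 b"
    using slopes_constant[OF D assms(3) nat DD] by auto
  have "coprime a b"
    using coprime_slopes[OF D assms(3)] unfolding ab
    by (metis coprimeE coprimeI const2_dvd_1_iff const2_dvd_const2_iff)
  then interpret constant_coefficient_derivation D a b
    using D ab nat by unfold_locales
  have "(of_nat (Suc n) :: 'r poly poly) dvd 1" for n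
    using unit[of n] by (metis const2_dvd_1_iff const2_of_nat)
  then have "ideal_power (Ker D) (ideal_of (Ker D) hull (D ` {X1, X2})) j \<subseteq> image_ideal D j"
    using DD by (intro ideal_power_subset_image_ideal[OF D]) auto
  then show ?thesis using image_ideal_subset by auto
qed

end
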